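(* Let $\rho=\frac{3-\sqrt5}{2}$, and for integers $k,j\ge1$ put $U(k,j)=k$, $\pi(k)=\frac{\sqrt5+1}{2}\rho^k$, $C_2(j)=j(\sqrt5-2)\rho^{j-1}$, $C_2=\sum_{j\ge1}C_2(j)=\frac{\sqrt5-1}{2}$, and $$P(k,j)=\pi(k)U(k,j)C_2(j)=\pi(k)\,k\,C_2(j).$$ Then $P$ is the asymptotic joint distribution of the sizes of two intermediate successive columns of a directed column-convex polyomino (dcc): if $\Xi(m,n,m_1,k,j)$ denotes the number of dcc of area $n$ and width $m$ whose column $m_1$ has size $k$ and whose column $m_1+1$ has size $j$, and $T(m,n)$ denotes the number of dcc of area $n$ and width $m$, then for all fixed $k,j\ge 1$, $$\frac{\Xi(m,n,m_1,k,j)}{T(m,n)}\longrightarrow P(k,j)$$ as $n\to\infty$ with $m-\frac{n}{\sqrt5}=O(\sqrt n)$ and with $m_1$ and $m-m_1$ both of order $n$ (bounded below by a positive constant times $n$). Consequently, the asymptotic stationary distribution $\pi_2$ of the column size and the asymptotic transition matrix $\Pi$ of the Markov chain of successive column sizes are given by $$\pi_2(k)=\sum_{j\ge1}P(k,j)=\sum_{j\ge1}\pi(k)U(k,j)C_2(j)=\pi(k)\,k\,C_2=k\rho^k,$$ $$\pi_2(j)=\sum_{k\ge1}P(k,j)=\sum_{k\ge1}\pi(k)U(k,j)C_2(j),$$ $$\Pi(k,j)=\frac{P(k,j)}{\sum_{i\ge1}P(k,i)}=\frac{U(k,j)C_2(j)}{\sum_{i\ge1}U(k,i)C_2(i)}=\frac{C_2(j)}{C_2}=j\rho^j,$$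 and they satisfy $\sum_{k\ge1}\pi_2(k)\Pi(k,j)=\pi_2(j)$ for all $j\ge1$.
   Context: Polyominoes are sets of cells of the square lattice, counted up to translation. A directed column-convex polyomino (dcc) is made of finitely many consecutive non-empty columns, each consisting of vertically contiguous cells (no holes), such that the base (lowest) cell of each column other than the first is adjacent to some cell of the previous column; thus a column of size $k$ can be followed by a column of size $j$ in exactly $U(k,j)=k$ ways. The area is the number of cells, the width is the number of columns, the size of a column is its number of cells, and columns are numbered $1,\dots,m$ from left to right. *)

theory Defs
  imports "HOL-Analysis.Analysis" "HOL-Library.Landau_Symbols"
begin

section \<open>Directed column-convex polyominoes\<close>

text \<open>A cell of the square lattice is named by its (abscissa, ordinate).\<close>

type_synonym cell = "int \<times> int"

definition adjacent :: "cell \<Rightarrow> cell \<Rightarrow> bool" where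
  "adjacent c d \<longleftrightarrow> \<bar>fst c - fst d\<bar> + \<bar>snd c - snd d\<bar> = 1"

text \<open>The ordinates of the cells of \<open>S\<close> with abscissa \<open>x\<close>.\<close>

definition column_at :: "cell set \<Rightarrow> int \<Rightarrow> int set" where
  "column_at S x = {y. (x, y) \<in> S}"

text \<open>The conjuncts say: the non-empty columns are finite in number and consecutive; each
  of them is vertically contiguous and finite; the base cell of each column other than the
  first is adjacent to a cell of the preceding column.\<close>

definition dcc :: "cell set \<Rightarrow> bool" where
  "dcc S \<longleftrightarrow>
     S \<noteq> {} \<and>
     (\<exists>a b. fst ` S = {a..b}) \<and>
     (\<forall>x \<in> fst ` S. \<exists>l u. column_at S x = {l..u}) \<and>
     (\<forall>x \<in> fst ` S. x \<noteq> Min (fst ` S) \<longrightarrow>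
        (\<exists>y \<in> column_at S (x - 1). adjacent (x, Min (column_at S x)) (x - 1, y)))"

definition area :: "cell set \<Rightarrow> nat" where
  "area S = card S"

definition width :: "cell set \<Rightarrow> nat" where
  "width S = card (fst ` S)"

text \<open>Columns are numbered from \<open>1\<close>, starting at the leftmost one; the size is \<open>0\<close> for an
  index outside \<open>{1..width S}\<close>.\<close>

definition column_size :: "cell set \<Rightarrow> nat \<Rightarrow> nat" where
  "column_size S i = card (column_at S (Min (fst ` S) + int i - 1))"

definition translate :: "cell \<Rightarrow> cell set \<Rightarrow> cell set" where
  "translate v S = (\<lambda>c. c + v) ` S"

definition translation_rel :: "(cell set \<times> cell set) set" where
  "translation_rel = {(S, S'). \<exists>v. S' = translate v S}"

lemma equiv_translation_rel: "equiv UNIV translation_rel"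
proof (rule equivI)
  show "refl translation_rel"
  proof (rule reflI)
    fix S :: "cell set"
    have "S = translate 0 S" by (simp add: translate_def)
    then show "(S, S) \<in> translation_rel" unfolding translation_rel_def by blast
  qed
  show "sym translation_rel"
  proof (rule symI)
    fix S S' assume "(S, S') \<in> translation_rel"
    then obtain v where "S' = translate v S" unfolding translation_rel_def by blast
    then have "S = translate (- v) S'" by (simp add: translate_def image_image)
    then show "(S', S) \<in> translation_rel" unfolding translation_rel_def by blast
  qed
  show "trans translation_rel"
  proof (rule transI)
    fix S S' S'' assume "(S, S') \<in> translation_rel" "(S', S'') \<in> translation_rel"
    then obtain v w where "S' = translate v S" "S'' = translate w S'"
      unfolding translation_rel_def by blast
    then have "S'' = translate (v + w) S" by (simp add: translate_def image_image add.assoc)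
    then show "(S, S'') \<in> translation_rel" unfolding translation_rel_def by blast
  qed
qed simp

text \<open>The predicates counted below are invariant under translation, so each class in the
  quotient consists of polyominoes satisfying them.\<close>

definition count_up_to_translation :: "(cell set \<Rightarrow> bool) \<Rightarrow> nat" where
  "count_up_to_translation Q = card ({S. Q S} // translation_rel)"

definition T :: "nat \<Rightarrow> nat \<Rightarrow> nat" where
  "T m n = count_up_to_translation (\<lambda>S. dcc S \<and> area S = n \<and> width S = m)"

definition Xi :: "nat \<Rightarrow> nat \<Rightarrow> nat \<Rightarrow> nat \<Rightarrow> nat \<Rightarrow> nat" where
  "Xi m n m1 k j = count_up_to_translation (\<lambda>S. dcc S \<and> area S = n \<and> width S = m \<and>
     column_size S m1 = k \<and> column_size S (m1 + 1) = j)"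

text \<open>Dcc of area \<open>n\<close> and width \<open>m\<close> whose column \<open>i\<close> has size \<open>k\<close>.\<close>

definition Xi_col :: "nat \<Rightarrow> nat \<Rightarrow> nat \<Rightarrow> nat \<Rightarrow> nat" where
  "Xi_col m n i k = count_up_to_translation (\<lambda>S. dcc S \<and> area S = n \<and> width S = m \<and>
     column_size S i = k)"

text \<open>The asymptotic regime, with \<open>m\<close> and \<open>m1\<close> as functions of \<open>n\<close>. The difference \<open>m - m1\<close> is taken
  over the reals, so that the last bound forces \<open>m1 n < m n\<close> for large \<open>n\<close>.\<close>

definition regime :: "(nat \<Rightarrow> nat) \<Rightarrow> (nat \<Rightarrow> nat) \<Rightarrow> bool" where
  "regime m m1 \<longleftrightarrow>
     (\<lambda>n. real (m n) - real n / sqrt 5) \<in> O(\<lambda>n. sqrt (real n)) \<and>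
     (\<exists>c>0. \<forall>\<^sub>F n in sequentially.
        c * real n \<le> real (m1 n) \<and> c * real n \<le> real (m n) - real (m1 n))"

section \<open>Limiting quantities\<close>

text \<open>All of the following are meant for indices \<open>k, j \<ge> 1\<close>.\<close>

definition rho :: real where
  "rho = (3 - sqrt 5) / 2"

definition U :: "nat \<Rightarrow> nat \<Rightarrow> real" where
  "U k j = real k"

definition pi1 :: "nat \<Rightarrow> real" where
  "pi1 k = (sqrt 5 + 1) / 2 * rho ^ k"

definition C2 :: "nat \<Rightarrow> real" where
  "C2 j = real j * (sqrt 5 - 2) * rho ^ (j - 1)"

definition C2_total :: real where
  "C2_total = (\<Sum>\<^sub>\<infinity>j\<in>{1..}. C2 j)"

definition P :: "nat \<Rightarrow> nat \<Rightarrow> real" where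
  "P k j = pi1 k * U k j * C2 j"

definition pi2 :: "nat \<Rightarrow> real" where
  "pi2 k = (\<Sum>\<^sub>\<infinity>j\<in>{1..}. P k j)"

definition Trans :: "nat \<Rightarrow> nat \<Rightarrow> real" where
  "Trans k j = P k j / (\<Sum>\<^sub>\<infinity>i\<in>{1..}. P k i)"

end

theory Submission
  imports Defs
begin

text \<open>A dcc is determined, up to translation, by its column sizes \<open>k\<^sub>1, \<dots>, k\<^sub>m\<close> and
  by the height at which each column starts on the preceding one. Column \<open>i < m\<close> offers \<open>k\<^sub>i\<close>
  places to the base of its successor, and the last column offers its places to nobody. Writing the
  choice made on a column next to its size gives a word over the letters \<open>(k, d)\<close> with \<open>d < k\<close>, the
  last letter having \<open>d = 0\<close>; counting dcc up to translation becomes counting such words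
  (\<open>count_up_to_translation_eq_card_codes\<close>).

  The point of the proof is that an intermediate column can be cut out. Deleting a letter other
  than the last from a word leaves a word, and the deleted letter of size \<open>k\<close> could have been any of
  \<open>k\<close> letters (\<open>card_codes_fixed_column\<close>). So the exact identities
  \<open>Xi_col m n i k = k * T (m - 1) (n - k)\<close> and \<open>Xi m n i k j = k * j * T (m - 2) (n - k - j)\<close> hold,
  whatever the position \<open>i\<close>, as long as the last column is not among those cut out. Position therefore has no
  influence on the limits, and everything is reduced to the behaviour of \<open>T\<close> when its arguments
  change by a bounded amount.

  Deleting the first letter gives a recursion for \<open>T\<close> whose solution is the binomial coefficient
  \<open>T m n = (n + m - 2) choose (2 * m - 2)\<close> (\<open>T_eq_choose\<close>). Its ratios are rational functions of
  \<open>m\<close> and \<open>n\<close>: \<open>T m (n - 1) / T m n = (n - m) / (n + m - 2)\<close> tends to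
  \<open>(1 - 1/\<surd>5) / (1 + 1/\<surd>5) = rho\<close> when \<open>m / n\<close> tends to \<open>1/\<surd>5\<close>, and
  \<open>T (m - 1) n / T m n\<close> tends to \<open>(4/5) / (1 - 1/5) = 1\<close>; the density \<open>1/\<surd>5\<close> is exactly the one
  for which a column can be removed at no cost. Hence cutting out a column of size \<open>k\<close> multiplies
  the count by \<open>rho ^ k\<close> in the limit, a column has size \<open>k\<close> with asymptotic probability
  \<open>k * rho ^ k\<close>, and two successive columns have sizes \<open>k\<close> and \<open>j\<close> with asymptotic probability
  \<open>(k * rho ^ k) * (j * rho ^ j)\<close>.

  This product is \<open>P k j\<close> (\<open>P_eq\<close>): successive sizes are asymptotically independent, the transition
  probabilities do not depend on the starting size, and all the identities between \<open>P\<close>, \<open>pi2\<close>,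
  \<open>Trans\<close> and \<open>C2\<close> follow from the single sum \<open>(\<Sum>k\<ge>1. k * rho ^ k) = rho / (1 - rho)\<^sup>2 = 1\<close>.\<close>

section \<open>Coding directed column-convex polyominoes by words\<close>

text \<open>A letter \<open>(k, d)\<close> stands for a column of size \<open>k\<close> on whose cell number \<open>d\<close>, counted from \<open>0\<close>
  at the bottom, the next column is based. Thus \<open>base y w i\<close> is the ordinate of the base of column
  \<open>i\<close>, columns being numbered from \<open>0\<close> here.\<close>

definition base :: "int \<Rightarrow> (nat \<times> nat) list \<Rightarrow> nat \<Rightarrow> int" where
  "base y w i = y + int (sum_list (map snd (take i w)))"

definition draw :: "int \<Rightarrow> int \<Rightarrow> (nat \<times> nat) list \<Rightarrow> cell set" where
  "draw x y w = {(c, v). \<exists>i<length w. c = x + int i \<and> v \<in> {base y w i..<base y w i + int (fst (w ! i))}}"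

text \<open>The condition \<open>d < k\<close> also forces columns to be non-empty. The last column has no successor;
  fixing its second component to \<open>0\<close> makes the code of a polyomino unique.\<close>

definition code :: "(nat \<times> nat) list \<Rightarrow> bool" where
  "code w \<longleftrightarrow> w \<noteq> [] \<and> (\<forall>(k, d) \<in> set w. d < k) \<and> snd (last w) = 0"

lemma base_0: "base y w 0 = y"
  by (simp add: base_def)

lemma base_Suc: "i < length w \<Longrightarrow> base y w (Suc i) = base y w i + int (snd (w ! i))"
  by (simp add: base_def take_Suc_conv_app_nth)

lemma code_nth: "code w \<Longrightarrow> i < length w \<Longrightarrow> snd (w ! i) < fst (w ! i)"
  unfolding code_def by (metis (mono_tags, lifting) case_prod_beta nth_mem)

lemma column_at_draw:
  "i < length w \<Longrightarrow>
   column_at (draw x y w) (x + int i) = {base y w i..<base y w i + int (fst (w ! i))}"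
  by (auto simp: column_at_def draw_def)

lemma fst_draw:
  assumes "code w"
  shows "fst ` draw x y w = {x..x + int (length w) - 1}"
proof
  show "fst ` draw x y w \<subseteq> {x..x + int (length w) - 1}"
    by (auto simp: draw_def)
  show "{x..x + int (length w) - 1} \<subseteq> fst ` draw x y w"
  proof
    fix c assume c: "c \<in> {x..x + int (length w) - 1}"
    define i where "i = nat (c - x)"
    have i: "i < length w" "c = x + int i"
      using c by (auto simp: i_def)
    have "(c, base y w i) \<in> draw x y w"
      using i code_nth[OF assms i(1)] by (auto simp: draw_def)
    then show "c \<in> fst ` draw x y w" by force
  qed
qed

lemma Min_fst_draw: "code w \<Longrightarrow> Min (fst ` draw x y w) = x"
  by (simp add: fst_draw) (metis (no_types, lifting) Min_eqI atLeastAtMost_iff code_def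
      finite_atLeastAtMost_int length_greater_0_conv of_nat_0_less_iff order_refl
      zle_diff1_eq less_add_same_cancel1)

lemma Min_int_interval: "a < b \<Longrightarrow> Min {a..<b::int} = a"
  by (rule Min_eqI) auto

lemma width_draw: "code w \<Longrightarrow> width (draw x y w) = length w"
  by (simp add: width_def fst_draw)

lemma column_size_draw:
  "code w \<Longrightarrow> i < length w \<Longrightarrow> column_size (draw x y w) (Suc i) = fst (w ! i)"
  using column_at_draw[of i w x y] by (simp add: column_size_def Min_fst_draw)

lemma area_draw: "area (draw x y w) = sum_list (map fst w)"
proof -
  let ?A = "SIGMA i:{..<length w}. {base y w i..<base y w i + int (fst (w ! i))}"
  have "draw x y w = (\<lambda>(i, v). (x + int i, v)) ` ?A"
    by (auto simp: draw_def image_iff)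
  moreover have "inj_on (\<lambda>(i, v). (x + int i, v)) ?A"
    by (auto simp: inj_on_def)
  ultimately have "area (draw x y w) = card ?A"
    by (simp add: area_def card_image)
  also have "\<dots> = (\<Sum>i<length w. fst (w ! i))"
    by (subst card_SigmaI) auto
  finally show ?thesis
    by (simp add: sum_list_sum_nth atLeast0LessThan)
qed

lemma translate_draw: "translate (a, b) (draw x y w) = draw (x + a) (y + b) w"
proof (intro set_eqI iffI; clarify)
  fix c v
  show "(c, v) \<in> draw (x + a) (y + b) w" if "(c, v) \<in> translate (a, b) (draw x y w)"
    using that by (force simp: translate_def draw_def base_def)
  show "(c, v) \<in> translate (a, b) (draw x y w)" if "(c, v) \<in> draw (x + a) (y + b) w"
  proof -
    have "(c - a, v - b) \<in> draw x y w"
      using that by (force simp: draw_def base_def)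
    then show ?thesis
      unfolding translate_def by (force simp: image_iff)
  qed
qed

lemma dcc_draw:
  assumes w: "code w"
  shows "dcc (draw x y w)"
  unfolding dcc_def
proof (intro conjI ballI impI)
  have len: "length w > 0" using w by (simp add: code_def)
  show "draw x y w \<noteq> {}"
    using fst_draw[OF w, of x y] len by auto
  show "\<exists>a b. fst ` draw x y w = {a..b}"
    using fst_draw[OF w] by blast
  fix c assume c: "c \<in> fst ` draw x y w"
  define i where "i = nat (c - x)"
  have i: "i < length w" "c = x + int i"
    using c by (auto simp: i_def fst_draw[OF w])
  show "\<exists>l u. column_at (draw x y w) c = {l..u}"
  proof (intro exI)
    show "column_at (draw x y w) c = {base y w i..base y w i + int (fst (w ! i)) - 1}"
      using column_at_draw[OF i(1)] i(2) by auto
  qed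
  assume "c \<noteq> Min (fst ` draw x y w)"
  then have "i > 0" using i(2) by (cases i) (auto simp: Min_fst_draw[OF w])
  then obtain h where h: "i = Suc h" by (cases i) auto
  have "Min (column_at (draw x y w) c) = base y w i"
    unfolding i(2) column_at_draw[OF i(1)]
    by (rule Min_int_interval) (use code_nth[OF w i(1)] in simp)
  moreover have "c - 1 = x + int h" using i h by simp
  moreover have "base y w i \<in> column_at (draw x y w) (x + int h)"
    using i(1) h code_nth[OF w, of h] by (simp add: column_at_draw base_Suc)
  ultimately show "\<exists>v\<in>column_at (draw x y w) (c - 1).
      adjacent (c, Min (column_at (draw x y w) c)) (c - 1, v)"
    by (intro bexI[of _ "base y w i"]) (auto simp: adjacent_def)
qed

text \<open>The drawing determines the abscissa of the first column, the base and the size of every column,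
  and the offsets as differences of successive bases; only the offset of the last letter leaves no
  trace, and the definition of a code fixes it.\<close>

lemma draw_inject:
  assumes w: "code w" and w': "code w'" and eq: "draw x y w = draw x' y' w'"
  shows "x = x'" and "y = y'" and "w = w'"
proof -
  show x: "x = x'"
    using Min_fst_draw[OF w, of x y] Min_fst_draw[OF w', of x' y'] eq by simp
  have len: "length w = length w'"
    using width_draw[OF w, of x y] width_draw[OF w', of x' y'] eq by simp
  have col: "base y w i = base y' w' i" "fst (w ! i) = fst (w' ! i)" if i: "i < length w" for i
  proof -
    have e: "{base y w i..<base y w i + int (fst (w ! i))} =
        {base y' w' i..<base y' w' i + int (fst (w' ! i))}"
      using column_at_draw[OF i, of x y] column_at_draw[of i w' x' y'] i len eq x by simp
    from e have "Min {base y w i..<base y w i + int (fst (w ! i))} =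
        Min {base y' w' i..<base y' w' i + int (fst (w' ! i))}" by simp
    then show "base y w i = base y' w' i"
      using code_nth[OF w i] code_nth[OF w', of i] i len by (simp add: Min_int_interval)
    from arg_cong[OF e, of card] show "fst (w ! i) = fst (w' ! i)" by simp
  qed
  show "y = y'"
    using col(1)[of 0] w by (simp add: base_0 code_def)
  show "w = w'"
  proof (rule nth_equalityI[OF len])
    fix i assume i: "i < length w"
    have "snd (w ! i) = snd (w' ! i)"
    proof (cases "Suc i < length w")
      case True
      then show ?thesis
        using col(1)[OF i] col(1)[OF True] i len by (simp add: base_Suc)
    next
      case False
      then have "w ! i = last w" "w' ! i = last w'"
        using i len w w' by (auto simp: last_conv_nth code_def dest!: less_antisym)
      then show ?thesis
        using w w' by (simp add: code_def)
    qed
    with col(2)[OF i] show "w ! i = w' ! i" by (simp add: prod_eq_iff)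
  qed
qed

text \<open>Reading off the code of a dcc: the base of a column lies on a cell of the preceding column, because
  two adjacent cells in neighbouring columns have the same ordinate.\<close>

lemma dcc_imp_draw:
  assumes S: "dcc S"
  shows "\<exists>x y w. code w \<and> S = draw x y w"
proof -
  obtain a b where ab: "fst ` S = {a..b}" and ne: "S \<noteq> {}"
    using S by (auto simp: dcc_def)
  have le: "a \<le> b" using ab ne by force
  define m where "m = nat (b - a + 1)"
  have m: "m > 0" "b = a + int m - 1" using le by (auto simp: m_def)
  have Mina: "Min (fst ` S) = a"
    unfolding ab by (rule Min_eqI) (use le in auto)
  define C where "C i = column_at S (a + int i)" for i
  define l where "l i = Min (C i)" for i
  have inS: "a + int i \<in> fst ` S" if "i < m" for i
    using that m by (simp add: ab)
  have C: "finite (C i)" "C i \<noteq> {}" "C i = {l i..<l i + int (card (C i))}" if i: "i < m" for i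
  proof -
    obtain p q where pq: "C i = {p..q}"
      using S inS[OF i] unfolding dcc_def C_def by blast
    show ne: "C i \<noteq> {}"
      using inS[OF i] by (force simp: C_def column_at_def)
    then have "p \<le> q" using pq by auto
    then have "l i = p" unfolding l_def pq by (intro Min_eqI) auto
    moreover have "int (card (C i)) = q - p + 1"
      using \<open>p \<le> q\<close> by (simp add: pq)
    moreover have "{p..q} = {p..<p + (q - p + 1)}"
      by auto
    ultimately show "C i = {l i..<l i + int (card (C i))}"
      by (simp only: pq)
    show "finite (C i)" using pq by simp
  qed
  have step: "l (Suc i) \<in> C i" if "Suc i < m" for i
  proof -
    have "a + int (Suc i) \<in> fst ` S" "a + int (Suc i) \<noteq> Min (fst ` S)"
      using inS[OF that] Mina by auto
    then obtain v where "v \<in> column_at S (a + int (Suc i) - 1)"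
      "adjacent (a + int (Suc i), Min (column_at S (a + int (Suc i)))) (a + int (Suc i) - 1, v)"
      using S unfolding dcc_def by blast
    then show ?thesis
      by (simp add: adjacent_def C_def l_def)
  qed
  have lC: "l i \<le> v \<and> v < l i + int (card (C i))" if "v \<in> C i" "i < m" for v i
  proof -
    have "v \<in> {l i..<l i + int (card (C i))}"
      using that(1) by (rule C(3)[OF that(2), THEN equalityD1, THEN subsetD])
    then show ?thesis by simp
  qed
  \<comment> \<open>the truncation by \<open>nat\<close> is harmless, by \<open>step\<close> and \<open>lC\<close>\<close>
  define w where "w = map (\<lambda>i. (card (C i), if Suc i < m then nat (l (Suc i) - l i) else 0)) [0..<m]"
  have len: "length w = m" by (simp add: w_def)
  have nth: "w ! i = (card (C i), if Suc i < m then nat (l (Suc i) - l i) else 0)" if "i < m" for i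
    using that by (simp add: w_def)
  have base: "base (l 0) w i = l i" if "i < m" for i
    using that
  proof (induction i)
    case (Suc i)
    then show ?case
      using lC[OF step[OF Suc.prems]] by (simp add: base_Suc len nth)
  qed (simp add: base_0)
  have "snd (w ! i) < fst (w ! i)" if "i < m" for i
    using lC[OF step, of i] C(1,2)[OF that] that by (auto simp: nth card_gt_0_iff)
  moreover have "snd (last w) = 0"
    using m nth[of "m - 1"] len by (subst last_conv_nth) auto
  ultimately have "code w"
    using m len unfolding code_def by (auto simp: in_set_conv_nth) (metis fst_conv snd_conv)
  moreover have "S = draw a (l 0) w"
  proof (intro set_eqI iffI; clarify)
    fix c v assume cv: "(c, v) \<in> S"
    define i where "i = nat (c - a)"
    have "c \<in> {a..b}" unfolding ab[symmetric] using cv by force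
    then have i: "i < m" "c = a + int i" using m by (auto simp: i_def)
    have "v \<in> C i" using cv i by (simp add: C_def column_at_def)
    then show "(c, v) \<in> draw a (l 0) w"
      using i lC[of v i] by (auto simp: draw_def len base nth)
  next
    fix c v assume "(c, v) \<in> draw a (l 0) w"
    then obtain i where i: "i < m" "c = a + int i" "v \<in> {l i..<l i + int (card (C i))}"
      by (auto simp: draw_def len base nth)
    then have "v \<in> C i" using C(3) by blast
    then show "(c, v) \<in> S" using i by (simp add: C_def column_at_def)
  qed
  ultimately show ?thesis by blast
qed

text \<open>Translating a drawing only moves its starting point, so each translation class of dcc contains
  exactly one drawing that starts at the origin.\<close>

lemma count_up_to_translation_eq_card_codes:
  assumes draw: "\<And>x y w. code w \<Longrightarrow> Q (draw x y w) \<longleftrightarrow> R w"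
    and dcc: "\<And>S. Q S \<Longrightarrow> dcc S"
  shows "count_up_to_translation Q = card {w. code w \<and> R w}"
proof -
  let ?f = "\<lambda>w. translation_rel `` {draw 0 0 w}"
  have inj: "inj_on ?f {w. code w \<and> R w}"
  proof (rule inj_onI)
    fix w w' assume w: "w \<in> {w. code w \<and> R w}" and w': "w' \<in> {w. code w \<and> R w}" and "?f w = ?f w'"
    then have "(draw 0 0 w, draw 0 0 w') \<in> translation_rel"
      using equiv_translation_rel by (meson UNIV_I eq_equiv_class)
    then obtain v where "draw 0 0 w' = translate v (draw 0 0 w)"
      by (auto simp: translation_rel_def)
    then have "draw 0 0 w' = draw (fst v) (snd v) w"
      using translate_draw[of "fst v" "snd v" 0 0 w] by simp
    then show "w = w'" using w w' draw_inject(3) by blast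
  qed
  have "?f ` {w. code w \<and> R w} = {S. Q S} // translation_rel"
  proof (intro equalityI subsetI)
    fix X assume "X \<in> ?f ` {w. code w \<and> R w}"
    then show "X \<in> {S. Q S} // translation_rel"
      using draw by (auto intro: quotientI)
  next
    fix X assume "X \<in> {S. Q S} // translation_rel"
    then obtain S where S: "Q S" "X = translation_rel `` {S}"
      by (auto elim: quotientE)
    obtain x y w where w: "code w" "S = draw x y w"
      using dcc_imp_draw[OF dcc[OF S(1)]] by blast
    have "(draw 0 0 w, S) \<in> translation_rel"
      using translate_draw[of x y 0 0 w] w unfolding translation_rel_def by (metis (mono_tags,
          lifting) add_0 case_prodI mem_Collect_eq)
    then have "X = ?f w"
      using S(2) equiv_class_eq[OF equiv_translation_rel] by blast
    then show "X \<in> ?f ` {w. code w \<and> R w}" using draw w S by blast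
  qed
  then show ?thesis
    using card_image[OF inj] by (simp add: count_up_to_translation_def)
qed

section \<open>Counting codes\<close>

definition codes :: "nat \<Rightarrow> nat \<Rightarrow> (nat \<times> nat) list set" where
  "codes m n = {w. code w \<and> length w = m \<and> sum_list (map fst w) = n}"

lemma T_eq_card_codes: "T m n = card (codes m n)"
  unfolding T_def codes_def
  by (rule count_up_to_translation_eq_card_codes) (auto simp: dcc_draw width_draw area_draw)

lemma Xi_col_eq_card_codes:
  assumes "i < m"
  shows "Xi_col m n (Suc i) k = card {w \<in> codes m n. fst (w ! i) = k}"
proof -
  have "Xi_col m n (Suc i) k = card {w. code w \<and> (w \<in> codes m n \<and> fst (w ! i) = k)}"
    unfolding Xi_col_def
    by (rule count_up_to_translation_eq_card_codes)
      (use assms in \<open>auto simp: codes_def dcc_draw width_draw area_draw column_size_draw\<close>)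
  also have "\<dots> = card {w \<in> codes m n. fst (w ! i) = k}"
    by (rule arg_cong[of _ _ card]) (auto simp: codes_def)
  finally show ?thesis .
qed

lemma Xi_eq_card_codes:
  assumes "Suc i < m"
  shows "Xi m n (Suc i) k j = card {w \<in> codes m n. fst (w ! i) = k \<and> fst (w ! Suc i) = j}"
proof -
  have "Xi m n (Suc i) k j =
      card {w. code w \<and> (w \<in> codes m n \<and> fst (w ! i) = k \<and> fst (w ! Suc i) = j)}"
    unfolding Xi_def
    by (rule count_up_to_translation_eq_card_codes)
      (use assms in \<open>auto simp: codes_def dcc_draw width_draw area_draw column_size_draw\<close>)
  also have "\<dots> = card {w \<in> codes m n. fst (w ! i) = k \<and> fst (w ! Suc i) = j}"
    by (rule arg_cong[of _ _ card]) (auto simp: codes_def)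
  finally show ?thesis .
qed

lemma finite_codes: "finite (codes m n)"
proof (rule finite_subset)
  show "codes m n \<subseteq> {w. set w \<subseteq> {..n} \<times> {..n} \<and> length w = m}"
  proof (intro subsetI CollectI conjI)
    fix w p assume w: "w \<in> codes m n" and "p \<in> set w"
    then have "fst p \<le> n" "snd p < fst p"
      using member_le_sum_list[of "fst p" "map fst w"] by (auto simp: codes_def code_def)
    then show "p \<in> {..n} \<times> {..n}" by (cases p) auto
  qed (simp add: codes_def)
qed (simp add: finite_lists_length_eq)

text \<open>Cutting out an intermediate column. Since \<open>i < m\<close>, the letter at position \<open>i\<close> is not the last one
  of a word of length \<open>Suc m\<close>, so deleting it keeps the last letter and hence the conditions on a
  code; conversely a letter \<open>(k, d)\<close> can be inserted there for each \<open>d < k\<close>. The predicate \<open>Q\<close> on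
  the shortened word allows the argument to be repeated for the next column.\<close>

lemma card_codes_fixed_column:
  assumes i: "i < m"
  shows "card {w \<in> codes (Suc m) (n + k). fst (w ! i) = k \<and> Q (take i w @ drop (Suc i) w)} =
    k * card {w \<in> codes m n. Q w}"
proof -
  let ?ins = "\<lambda>(d, w). take i w @ (k, d) # drop i w"
  let ?A = "{..<k} \<times> {w \<in> codes m n. Q w}"
  let ?B = "{w \<in> codes (Suc m) (n + k). fst (w ! i) = k \<and> Q (take i w @ drop (Suc i) w)}"
  have "bij_betw ?ins ?A ?B"
  proof (rule bij_betw_byWitness[where f' = "\<lambda>w. (snd (w ! i), take i w @ drop (Suc i) w)"])
    show "\<forall>p\<in>?A. (\<lambda>w. (snd (w ! i), take i w @ drop (Suc i) w)) (?ins p) = p"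
      using i by (auto simp: codes_def nth_append min_def)
    show "\<forall>w\<in>?B. ?ins (snd (w ! i), take i w @ drop (Suc i) w) = w"
    proof
      fix w assume w: "w \<in> ?B"
      then have "length w = Suc m" "(k, snd (w ! i)) = w ! i" by (auto simp: codes_def)
      then show "?ins (snd (w ! i), take i w @ drop (Suc i) w) = w"
        using i by (simp add: min_def id_take_nth_drop[symmetric])
    qed
    show "?ins ` ?A \<subseteq> ?B"
    proof (rule image_subsetI)
      fix p assume "p \<in> ?A"
      then obtain d w where p: "p = (d, w)" and d: "d \<in> {..<k}" and w: "w \<in> codes m n" "Q w"
        by blast
      have len: "length w = m" and cw: "code w" and s: "sum_list (map fst w) = n"
        using w by (auto simp: codes_def)
      have td: "take i w @ drop i w = w" by simp
      have "sum_list (map fst (take i w)) + sum_list (map fst (drop i w)) = n"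
        using s by (metis td map_append sum_list_append)
      moreover have "set (take i w @ (k, d) # drop i w) = insert (k, d) (set w)"
        by (subst (3) td[symmetric]) (simp only: set_append set_simps; blast)
      moreover have "last (take i w @ (k, d) # drop i w) = last w"
        using i len by (simp add: last_drop)
      ultimately have "take i w @ (k, d) # drop i w \<in> codes (Suc m) (n + k)"
        using d cw len i unfolding codes_def code_def by auto
      then show "?ins p \<in> ?B"
        unfolding p using i len w by (simp add: nth_append min_def)
    qed
    show "(\<lambda>w. (snd (w ! i), take i w @ drop (Suc i) w)) ` ?B \<subseteq> ?A"
    proof (rule image_subsetI)
      fix w assume "w \<in> ?B"
      then have w: "w \<in> codes (Suc m) (n + fst (w ! i))" and q: "Q (take i w @ drop (Suc i) w)"
        and k: "k = fst (w ! i)"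
        by auto
      have len: "length w = Suc m" and cw: "code w" and s: "sum_list (map fst w) = n + fst (w ! i)"
        using w by (auto simp: codes_def)
      have td: "w = take i w @ w ! i # drop (Suc i) w"
        using i len by (intro id_take_nth_drop) simp
      have "sum_list (map fst (take i w)) + sum_list (map fst (drop (Suc i) w)) = n"
        using s arg_cong[OF td, of "\<lambda>w. sum_list (map fst w)"] by simp
      moreover have "set (take i w @ drop (Suc i) w) \<subseteq> set w"
        using set_take_subset set_drop_subset by fastforce
      moreover have "last (take i w @ drop (Suc i) w) = last w"
        using i len by (simp add: last_drop)
      ultimately have "take i w @ drop (Suc i) w \<in> codes m n"
        using cw len i unfolding codes_def code_def by auto
      then show "(snd (w ! i), take i w @ drop (Suc i) w) \<in> ?A"
        unfolding k using q code_nth[OF cw, of i] i len by simp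
    qed
  qed
  then have "card ?A = card ?B" by (rule bij_betw_same_card)
  then show ?thesis by (simp add: card_cartesian_product)
qed

lemma Xi_col_eq_T:
  assumes "Suc i < m" and "k \<le> n"
  shows "Xi_col m n (Suc i) k = k * T (m - 1) (n - k)"
  using assms Xi_col_eq_card_codes[of i m n k]
    card_codes_fixed_column[of i "m - 1" "n - k" k "\<lambda>_. True"]
  by (simp add: T_eq_card_codes)

text \<open>Once column \<open>i\<close> is cut out, the column that followed it takes its place, and is cut out in turn.\<close>

lemma Xi_eq_T:
  assumes "Suc (Suc i) < m" and "k + j \<le> n"
  shows "Xi m n (Suc i) k j = k * (j * T (m - 1 - 1) (n - k - j))"
proof -
  have "{w \<in> codes m n. fst (w ! i) = k \<and> fst ((take i w @ drop (Suc i) w) ! i) = j} =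
      {w \<in> codes m n. fst (w ! i) = k \<and> fst (w ! Suc i) = j}"
    using assms(1) by (auto simp: codes_def nth_append min_def)
  then have "Xi m n (Suc i) k j = k * card {w \<in> codes (m - 1) (n - k). fst (w ! i) = j}"
    using assms Xi_eq_card_codes[of i m n k j]
      card_codes_fixed_column[of i "m - 1" "n - k" k "\<lambda>w. fst (w ! i) = j"] by simp
  also have "card {w \<in> codes (m - 1) (n - k). fst (w ! i) = j} = j * T (m - 1 - 1) (n - k - j)"
    using assms Xi_col_eq_card_codes[of i "m - 1" "n - k" j] Xi_col_eq_T[of i "m - 1" j "n - k"]
    by simp
  finally show ?thesis .
qed

text \<open>The hockey-stick identity applied twice: raising \<open>r\<close> by one adds to the left-hand side an
  unweighted sum of binomial coefficients.\<close>

lemma sum_Suc_times_choose: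
  "(\<Sum>s\<le>r. Suc s * ((r - s + p) choose p)) = (r + p + 2) choose (p + 2)"
proof (induction r)
  case (Suc r)
  have "(\<Sum>s\<le>Suc r. Suc s * ((Suc r - s + p) choose p)) =
      (\<Sum>s\<le>Suc r. (Suc r - s + p) choose p) + (\<Sum>s\<le>Suc r. s * ((Suc r - s + p) choose p))"
    by (simp add: sum.distrib del: sum.atMost_Suc)
  also have "(\<Sum>s\<le>Suc r. (Suc r - s + p) choose p) = (\<Sum>s\<le>Suc r. (p + s) choose p)"
    by (rule sum.reindex_bij_witness[of _ "\<lambda>s. Suc r - s" "\<lambda>s. Suc r - s"]) (auto simp: add.commute)
  also have "\<dots> = (r + p + 2) choose (p + 1)"
    using choose_rising_sum(1)[of p "Suc r"] by (simp add: add_ac)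
  also have "(\<Sum>s\<le>Suc r. s * ((Suc r - s + p) choose p)) = (\<Sum>s\<le>r. Suc s * ((r - s + p) choose p))"
    by (subst sum.atMost_Suc_shift) simp
  also have "\<dots> = (r + p + 2) choose (p + 2)" by (rule Suc.IH)
  finally show ?case by simp
qed simp

text \<open>Cut out the first column, of size \<open>k\<close>.\<close>

lemma T_recursion: "T (Suc (Suc m)) n = (\<Sum>k=1..n. k * T (Suc m) (n - k))"
proof -
  have "codes (Suc (Suc m)) n = (\<Union>k\<in>{1..n}. {w \<in> codes (Suc (Suc m)) n. fst (w ! 0) = k})"
  proof (intro equalityI subsetI)
    fix w assume w: "w \<in> codes (Suc (Suc m)) n"
    then have "fst (w ! 0) \<le> n" "0 < fst (w ! 0)"
      using code_nth[of w 0] member_le_sum_list[of "fst (w ! 0)" "map fst w"]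
      by (auto simp: codes_def)
    with w show "w \<in> (\<Union>k\<in>{1..n}. {w \<in> codes (Suc (Suc m)) n. fst (w ! 0) = k})" by auto
  qed auto
  then have "card (codes (Suc (Suc m)) n) = card (\<Union>k\<in>{1..n}. {w \<in> codes (Suc (Suc m)) n. fst (w ! 0) = k})"
    by simp
  also have "\<dots> = (\<Sum>k=1..n. card {w \<in> codes (Suc (Suc m)) n. fst (w ! 0) = k})"
    by (rule card_UN_disjoint) (auto simp: finite_codes)
  also have "\<dots> = (\<Sum>k=1..n. k * card (codes (Suc m) (n - k)))"
  proof (rule sum.cong)
    fix k assume "k \<in> {1..n}"
    then show "card {w \<in> codes (Suc (Suc m)) n. fst (w ! 0) = k} = k * card (codes (Suc m) (n - k))"
      using card_codes_fixed_column[of 0 "Suc m" "n - k" k "\<lambda>_. True"] by simp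
  qed simp
  finally show ?thesis by (simp add: T_eq_card_codes)
qed

lemma T_eq_0: "n < m \<Longrightarrow> T m n = 0"
proof -
  assume "n < m"
  have False if w: "w \<in> codes m n" for w
  proof -
    have "(\<Sum>i<length w. 1) \<le> (\<Sum>i<length w. fst (w ! i))"
      using w code_nth[of w] by (intro sum_mono) (fastforce simp: codes_def)
    then show False
      using w \<open>n < m\<close> by (simp add: codes_def sum_list_sum_nth atLeast0LessThan)
  qed
  then have "codes m n = {}" by blast
  then show ?thesis by (simp add: T_eq_card_codes)
qed

text \<open>The arguments are shifted to avoid truncated subtraction; in terms of the width \<open>m\<close> and the area
  \<open>n\<close> the value is \<open>(n + m - 2) choose (2 * m - 2)\<close>.\<close>

lemma T_eq_choose: "T (Suc m) (Suc m + r) = (r + 2 * m) choose (2 * m)"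
proof (induction m arbitrary: r)
  case 0
  have "codes (Suc 0) (Suc r) = {[(Suc r, 0)]}"
    by (auto simp: codes_def code_def length_Suc_conv)
  then show ?case by (simp add: T_eq_card_codes)
next
  case (Suc m)
  have "T (Suc (Suc m)) (Suc (Suc m) + r) =
      (\<Sum>k=1..Suc (Suc m) + r. k * T (Suc m) (Suc (Suc m) + r - k))"
    by (rule T_recursion)
  \<comment> \<open>for larger \<open>k\<close> less than one cell per column would remain\<close>
  also have "\<dots> = (\<Sum>k=1..Suc r. k * T (Suc m) (Suc (Suc m) + r - k))"
    by (rule sum.mono_neutral_right) (auto simp: T_eq_0)
  also have "\<dots> = (\<Sum>s\<le>r. Suc s * T (Suc m) (Suc m + (r - s)))"
    by (rule sum.reindex_bij_witness[of _ Suc "\<lambda>k. k - 1"]) (auto simp: Suc_diff_le)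
  also have "\<dots> = (\<Sum>s\<le>r. Suc s * ((r - s + 2 * m) choose (2 * m)))"
    by (simp only: Suc.IH)
  finally show ?case
    by (simp only: sum_Suc_times_choose) simp
qed

lemma T_pos: "0 < m \<Longrightarrow> m \<le> n \<Longrightarrow> 0 < T m n"
  using T_eq_choose[of "m - 1" "n - m"] by simp

lemma T_decrease_area:
  assumes "0 < m" "m < n"
  shows "real (T m (n - 1)) * (real n + real m - 2) = real (T m n) * (real n - real m)"
proof -
  define a r where "a = m - 1" and "r = n - m - 1"
  have mn: "m = Suc a" "n = Suc a + Suc r" using assms by (auto simp: a_def r_def)
  have "(Suc r) * (Suc (r + 2 * a) choose (2 * a)) = (Suc (r + 2 * a)) * ((r + 2 * a) choose (2 * a))"
    using binomial_absorb_comp[of "Suc (r + 2 * a)" "2 * a"] by simp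
  then have "real (Suc r) * real (Suc r + 2 * a choose (2 * a)) =
      real (Suc (r + 2 * a)) * real ((r + 2 * a) choose (2 * a))"
    by (metis add_Suc of_nat_mult)
  then show ?thesis
    using T_eq_choose[of a r] T_eq_choose[of a "Suc r"] mn by (simp add: algebra_simps)
qed

lemma T_decrease_width:
  assumes "1 < m" "m \<le> n"
  shows "real (T (m - 1) n) * ((real n + real m - 2) * (real n - real m + 1)) =
    real (T m n) * ((2 * real m - 2) * (2 * real m - 3))"
proof -
  define a r where "a = m - 2" and "r = n - m"
  have mn: "m = Suc (Suc a)" "n = Suc (Suc a) + r" using assms by (auto simp: a_def r_def)
  let ?x = "r + 2 * a"
  have 1: "(2 * a + 2) * ((?x + 2) choose (2 * a + 2)) = (?x + 2) * ((?x + 1) choose (2 * a + 1))"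
    using binomial_absorption[of "2 * a + 1" "?x + 2"] by simp
  have 2: "(2 * a + 1) * ((?x + 1) choose (2 * a + 1)) = (r + 1) * ((?x + 1) choose (2 * a))"
    using binomial_absorption[of "2 * a" "?x + 1"] binomial_absorb_comp[of "?x + 1" "2 * a"] by simp
  have "(2 * a + 2) * (2 * a + 1) * ((?x + 2) choose (2 * a + 2)) =
      (?x + 2) * (r + 1) * ((?x + 1) choose (2 * a))"
    using 1 2 by (metis mult.assoc mult.left_commute)
  then have "(2 * real a + 2) * (2 * real a + 1) * real ((?x + 2) choose (2 * a + 2)) =
      (real ?x + 2) * (real r + 1) * real ((?x + 1) choose (2 * a))"
    by (metis (mono_tags, opaque_lifting) of_nat_1 of_nat_add of_nat_mult of_nat_numeral)
  moreover have "T (m - 1) n = (?x + 1) choose (2 * a)"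
    using T_eq_choose[of a "Suc r"] mn by simp
  moreover have "T m n = (?x + 2) choose (2 * a + 2)"
    using T_eq_choose[of "Suc a" r] mn by simp
  ultimately show ?thesis
    by (simp add: mn algebra_simps del: binomial_Suc_Suc)
qed


section \<open>Removing a cell or a column at density \<open>1/\<surd>5\<close>\<close>

lemma sqrt5_less: "sqrt 5 < (3::real)"
  by (rule real_less_lsqrt) auto

lemma sqrt5_greater: "2 < sqrt (5::real)"
  by (rule real_less_rsqrt) auto

text \<open>All that the counting needs from the regime: the area \<open>N\<close> tends to infinity and the width \<open>M\<close> is
  asymptotic to \<open>N/\<surd>5\<close>. Both sequences are general because the pairs obtained by removing cells
  and columns have to be considered as well.\<close>

definition critical :: "(nat \<Rightarrow> nat) \<Rightarrow> (nat \<Rightarrow> nat) \<Rightarrow> bool" where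
  "critical M N \<longleftrightarrow> filterlim (\<lambda>n. real (N n)) at_top sequentially \<and>
     (\<lambda>n. real (M n) / real (N n)) \<longlonglongrightarrow> 1 / sqrt 5"

text \<open>As \<open>1/3 < 1/\<surd>5 < 1/2\<close>, both \<open>M\<close> and \<open>N - M\<close> tend to infinity.\<close>

lemma critical_eventually:
  assumes "critical M N"
  shows "eventually (\<lambda>n. a < M n \<and> M n + b < N n) sequentially"
proof -
  have N: "filterlim (\<lambda>n. real (N n)) at_top sequentially"
    and l: "(\<lambda>n. real (M n) / real (N n)) \<longlonglongrightarrow> 1 / sqrt 5"
    using assms by (auto simp: critical_def)
  have "1 / sqrt 5 > (1 / 3 :: real)" "1 / sqrt 5 < (1 / 2 :: real)"
    using sqrt5_less sqrt5_greater by (auto simp: field_simps)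
  then have "eventually (\<lambda>n. real (M n) / real (N n) > 1 / 3) sequentially"
    "eventually (\<lambda>n. real (M n) / real (N n) < 1 / 2) sequentially"
    using order_tendstoD[OF l] by blast+
  moreover have "eventually (\<lambda>n. real (N n) > real (3 * a + 2 * b)) sequentially"
    using N by (simp add: filterlim_at_top_dense)
  ultimately show ?thesis
  proof eventually_elim
    case (elim n)
    then have "real (N n) / 3 < real (M n)" "real (M n) < real (N n) / 2"
      by (auto simp: field_simps)
    then have "real a < real (M n)" "real (M n) + real b < real (N n)"
      using elim(3) by auto
    then show ?case by linarith
  qed
qed

lemma critical_remove_cells:
  assumes "critical M N"
  shows "critical M (\<lambda>n. N n - k)"
proof -
  have N: "filterlim (\<lambda>n. real (N n)) at_top sequentially"
    and l: "(\<lambda>n. real (M n) / real (N n)) \<longlonglongrightarrow> 1 / sqrt 5"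
    using assms by (auto simp: critical_def)
  have N': "filterlim (\<lambda>n. real (N n - k)) at_top sequentially"
    by (rule filterlim_at_top_mono[OF filterlim_tendsto_add_at_top[OF tendsto_const[of "- real k"] N]])
      (auto intro!: always_eventually)
  have "(\<lambda>n. inverse (real (N n))) \<longlonglongrightarrow> 0"
    using N by (rule tendsto_inverse_0_at_top)
  then have "(\<lambda>n. (real (M n) / real (N n)) / (1 - real k * inverse (real (N n)))) \<longlonglongrightarrow> (1 / sqrt 5) / (1 - real k * 0)"
    by (intro tendsto_intros l) auto
  moreover have "eventually (\<lambda>n. (real (M n) / real (N n)) / (1 - real k * inverse (real (N n)))
      = real (M n) / real (N n - k)) sequentially"
    using critical_eventually[OF assms, of 0 k]
    by eventually_elim (auto simp: field_simps of_nat_diff)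
  ultimately have "(\<lambda>n. real (M n) / real (N n - k)) \<longlonglongrightarrow> (1 / sqrt 5) / (1 - real k * 0)"
    by (rule Lim_transform_eventually)
  then show ?thesis
    using N' by (simp add: critical_def)
qed

lemma critical_remove_column:
  assumes "critical M N"
  shows "critical (\<lambda>n. M n - 1) N"
proof -
  have N: "filterlim (\<lambda>n. real (N n)) at_top sequentially"
    and l: "(\<lambda>n. real (M n) / real (N n)) \<longlonglongrightarrow> 1 / sqrt 5"
    using assms by (auto simp: critical_def)
  have "(\<lambda>n. inverse (real (N n))) \<longlonglongrightarrow> 0"
    using N by (rule tendsto_inverse_0_at_top)
  then have "(\<lambda>n. real (M n) / real (N n) - inverse (real (N n))) \<longlonglongrightarrow> 1 / sqrt 5 - 0"
    by (intro tendsto_intros l)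
  moreover have "eventually (\<lambda>n. real (M n) / real (N n) - inverse (real (N n))
      = real (M n - 1) / real (N n)) sequentially"
    using critical_eventually[OF assms, of 0 0]
    by eventually_elim (auto simp: field_simps of_nat_diff)
  ultimately have "(\<lambda>n. real (M n - 1) / real (N n)) \<longlonglongrightarrow> 1 / sqrt 5 - 0"
    by (rule Lim_transform_eventually)
  then show ?thesis
    using N by (simp add: critical_def)
qed

text \<open>By \<open>T_decrease_area\<close> the ratio is \<open>(N - M) / (N + M - 2)\<close>; divide both terms by \<open>N\<close>.\<close>

lemma T_remove_cell_limit:
  assumes crit: "critical M N"
  shows "(\<lambda>n. real (T (M n) (N n - 1)) / real (T (M n) (N n))) \<longlonglongrightarrow> rho"
proof -
  have N: "filterlim (\<lambda>n. real (N n)) at_top sequentially"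
    and l: "(\<lambda>n. real (M n) / real (N n)) \<longlonglongrightarrow> 1 / sqrt 5"
    using crit by (auto simp: critical_def)
  have "(\<lambda>n. inverse (real (N n))) \<longlonglongrightarrow> 0"
    using N by (rule tendsto_inverse_0_at_top)
  moreover have "1 + 1 / sqrt 5 \<noteq> (0::real)"
    by (metis add_pos_pos divide_pos_pos less_irrefl real_sqrt_gt_zero zero_less_numeral zero_less_one)
  ultimately have "(\<lambda>n. (1 - real (M n) / real (N n)) / (1 + real (M n) / real (N n) - 2 * inverse (real (N n))))
      \<longlonglongrightarrow> (1 - 1 / sqrt 5) / (1 + 1 / sqrt 5 - 2 * 0)"
    by (intro tendsto_intros l) auto
  also have "(1 - 1 / sqrt 5) / (1 + 1 / sqrt 5 - 2 * 0) = rho"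
  proof -
    have "(1 - 1 / sqrt 5) / (1 + 1 / sqrt 5 - 2 * 0) = (sqrt 5 - 1) / (sqrt 5 + 1)"
      using sqrt5_greater by (simp add: field_simps)
    also have "\<dots> = rho"
      using sqrt5_greater by (simp add: rho_def field_simps)
    finally show ?thesis .
  qed
  finally have lim: "(\<lambda>n. (1 - real (M n) / real (N n)) / (1 + real (M n) / real (N n) - 2 * inverse (real (N n))))
      \<longlonglongrightarrow> rho" .
  have "eventually (\<lambda>n. (1 - real (M n) / real (N n)) / (1 + real (M n) / real (N n) - 2 * inverse (real (N n)))
      = real (T (M n) (N n - 1)) / real (T (M n) (N n))) sequentially"
    using critical_eventually[OF crit, of 1 0]
  proof eventually_elim
    case (elim n)
    have pos: "real (N n) > 0" "real (T (M n) (N n)) > 0" "real (N n) + real (M n) - 2 > 0"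
      using elim T_pos[of "M n" "N n"] by auto
    have "(1 - real (M n) / real (N n)) / (1 + real (M n) / real (N n) - 2 * inverse (real (N n))) =
        ((1 - real (M n) / real (N n)) * real (N n)) /
        ((1 + real (M n) / real (N n) - 2 * inverse (real (N n))) * real (N n))"
      using pos(1) by simp
    also have "\<dots> = (real (N n) - real (M n)) / (real (N n) + real (M n) - 2)"
      using pos(1) by (simp add: algebra_simps)
    also have "\<dots> = real (T (M n) (N n - 1)) / real (T (M n) (N n))"
      using pos T_decrease_area[of "M n" "N n"] elim by (simp add: frac_eq_eq mult.commute)
    finally show ?case .
  qed
  with lim show ?thesis by (rule Lim_transform_eventually)
qed

text \<open>By \<open>T_decrease_width\<close> the ratio is
  \<open>(2 * M - 2) * (2 * M - 3) / ((N + M - 2) * (N - M + 1))\<close>, which tends to \<open>4 * q\<^sup>2 / (1 - q\<^sup>2)\<close> when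
  \<open>M / N\<close> tends to \<open>q\<close>; this is \<open>1\<close> for \<open>q = 1/\<surd>5\<close>.\<close>

lemma T_remove_column_limit:
  assumes crit: "critical M N"
  shows "(\<lambda>n. real (T (M n - 1) (N n)) / real (T (M n) (N n))) \<longlonglongrightarrow> 1"
proof -
  have N: "filterlim (\<lambda>n. real (N n)) at_top sequentially"
    and l: "(\<lambda>n. real (M n) / real (N n)) \<longlonglongrightarrow> 1 / sqrt 5"
    using crit by (auto simp: critical_def)
  define e where "e n = inverse (real (N n))" for n
  define q where "q n = real (M n) / real (N n)" for n
  have e: "e \<longlonglongrightarrow> 0"
    using tendsto_inverse_0_at_top[OF N] by (simp add: e_def[abs_def])
  have q: "q \<longlonglongrightarrow> 1 / sqrt 5"
    using l by (simp add: q_def[abs_def])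
  let ?f = "\<lambda>n. ((2 * q n - 2 * e n) * (2 * q n - 3 * e n)) / ((1 + q n - 2 * e n) * (1 - q n + e n))"
  have nz: "(1 + 1 / sqrt 5) * (1 - 1 / sqrt 5) = (4 / 5 :: real)"
    by (simp add: field_simps)
  then have nz': "1 + 1 / sqrt 5 \<noteq> (0 :: real)" "1 - 1 / sqrt 5 \<noteq> (0 :: real)"
    by (metis mult_zero_left zero_neq_numeral divide_eq_0_iff, metis mult_zero_right zero_neq_numeral divide_eq_0_iff)
  have "?f \<longlonglongrightarrow> ((2 * (1 / sqrt 5) - 2 * 0) * (2 * (1 / sqrt 5) - 3 * 0)) /
      ((1 + 1 / sqrt 5 - 2 * 0) * (1 - 1 / sqrt 5 + 0))"
    by (intro tendsto_intros e q) (use nz' in simp)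
  then have lim: "?f \<longlonglongrightarrow> 1"
    using nz by simp
  have "eventually (\<lambda>n. ?f n = real (T (M n - 1) (N n)) / real (T (M n) (N n))) sequentially"
    using critical_eventually[OF crit, of 1 0]
  proof eventually_elim
    case (elim n)
    have pos: "real (N n) > 0" "real (T (M n) (N n)) > 0"
      "(real (N n) + real (M n) - 2) * (real (N n) - real (M n) + 1) > 0"
      using elim T_pos[of "M n" "N n"] by auto
    have eq: "q n * real (N n) = real (M n)" "e n * real (N n) = 1"
      using pos(1) by (auto simp: q_def e_def)
    have "?f n = (((2 * q n - 2 * e n) * real (N n)) * ((2 * q n - 3 * e n) * real (N n))) /
        (((1 + q n - 2 * e n) * real (N n)) * ((1 - q n + e n) * real (N n)))"
      using pos(1) by simp
    also have "\<dots> = ((2 * real (M n) - 2) * (2 * real (M n) - 3)) /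
        ((real (N n) + real (M n) - 2) * (real (N n) - real (M n) + 1))"
      by (simp add: left_diff_distrib distrib_right mult.assoc eq)
    also have "\<dots> = real (T (M n - 1) (N n)) / real (T (M n) (N n))"
      using pos T_decrease_width[of "M n" "N n"] elim by (subst frac_eq_eq) (auto simp: mult.commute)
    finally show ?case .
  qed
  with lim show ?thesis by (rule Lim_transform_eventually)
qed

lemma T_remove_column_cells_limit:
  assumes crit: "critical M N"
  shows "(\<lambda>n. real (T (M n - 1) (N n - k)) / real (T (M n) (N n))) \<longlonglongrightarrow> rho ^ k"
proof (induction k)
  case 0
  then show ?case using T_remove_column_limit[OF crit] by simp
next
  case (Suc k)
  let ?M = "\<lambda>n. M n - 1" and ?N = "\<lambda>n. N n - k"
  have crit': "critical ?M ?N"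
    by (intro critical_remove_cells critical_remove_column crit)
  have "(\<lambda>n. (real (T (?M n) (?N n - 1)) / real (T (?M n) (?N n))) *
      (real (T (?M n) (?N n)) / real (T (M n) (N n)))) \<longlonglongrightarrow> rho * rho ^ k"
    by (rule tendsto_mult[OF T_remove_cell_limit[OF crit'] Suc.IH])
  moreover have "eventually (\<lambda>n. (real (T (?M n) (?N n - 1)) / real (T (?M n) (?N n))) *
      (real (T (?M n) (?N n)) / real (T (M n) (N n))) =
      real (T (?M n) (N n - Suc k)) / real (T (M n) (N n))) sequentially"
    using critical_eventually[OF crit', of 0 0]
    by eventually_elim (use T_pos in \<open>simp add: less_imp_le\<close>)
  ultimately have "(\<lambda>n. real (T (?M n) (N n - Suc k)) / real (T (M n) (N n))) \<longlonglongrightarrow> rho * rho ^ k"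
    by (rule Lim_transform_eventually)
  then show ?case by simp
qed

section \<open>The limiting distributions\<close>

lemma rho_pos: "0 < rho" and rho_less_1: "rho < 1"
  using sqrt5_less sqrt5_greater by (auto simp: rho_def)

lemma one_minus_rho_sq: "(1 - rho)\<^sup>2 = rho"
  by (simp add: rho_def power2_eq_square field_simps)

text \<open>The sum of \<open>k * rho ^ k\<close> is \<open>rho / (1 - rho)\<^sup>2\<close>, and \<open>rho\<close> is a root of \<open>(1 - x)\<^sup>2 = x\<close>.\<close>

lemma has_sum_size_weights: "((\<lambda>k. real k * rho ^ k) has_sum 1) {1..}"
proof -
  have "(\<lambda>k. real (Suc k) * rho ^ k) sums (1 / (1 - rho)\<^sup>2)"
    using geometric_deriv_sums[of rho] rho_pos rho_less_1 by simp
  then have "(\<lambda>k. rho * (real (Suc k) * rho ^ k)) sums (rho * (1 / rho))"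
    unfolding one_minus_rho_sq by (rule sums_mult)
  then have "(\<lambda>k. real (Suc k) * rho ^ Suc k) sums 1"
    using rho_pos by (simp add: mult_ac)
  then have "((\<lambda>k. real (Suc k) * rho ^ Suc k) has_sum 1) UNIV"
    using rho_pos by (intro sums_nonneg_imp_has_sum) auto
  moreover have "bij_betw Suc UNIV {1..}"
    by (rule bij_betwI[of _ _ _ "\<lambda>k. k - 1"]) auto
  ultimately show ?thesis
    using has_sum_reindex_bij_betw[of Suc UNIV "{1..}" "\<lambda>k. real k * rho ^ k" 1] by simp
qed

lemma C2_eq: "1 \<le> j \<Longrightarrow> C2 j = (sqrt 5 - 1) / 2 * (real j * rho ^ j)"
proof -
  assume "1 \<le> j"
  then obtain i where j: "j = Suc i" by (cases j) auto
  have "sqrt 5 - 2 = (sqrt 5 - 1) / 2 * rho"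
    by (simp add: rho_def field_simps)
  then show ?thesis by (simp add: C2_def j)
qed

lemma has_sum_C2: "(C2 has_sum (sqrt 5 - 1) / 2) {1..}"
proof -
  have "((\<lambda>j. (sqrt 5 - 1) / 2 * (real j * rho ^ j)) has_sum (sqrt 5 - 1) / 2 * 1) {1..}"
    by (rule has_sum_cmult_right[OF has_sum_size_weights])
  then show ?thesis
    using has_sum_cong[of "{1..}" C2 "\<lambda>j. (sqrt 5 - 1) / 2 * (real j * rho ^ j)"] C2_eq by simp
qed

lemma C2_total_eq: "C2_total = (sqrt 5 - 1) / 2"
  unfolding C2_total_def by (rule infsumI[OF has_sum_C2])

lemma P_eq_product: "1 \<le> j \<Longrightarrow> P k j = (real k * rho ^ k) * (real j * rho ^ j)"
proof -
  assume j: "1 \<le> j"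
  have "P k j = ((sqrt 5 + 1) / 2 * ((sqrt 5 - 1) / 2)) * ((real k * rho ^ k) * (real j * rho ^ j))"
    by (simp add: P_def pi1_def U_def C2_eq[OF j] mult_ac)
  also have "(sqrt 5 + 1) / 2 * ((sqrt 5 - 1) / 2) = (1 :: real)"
    by (simp add: field_simps)
  finally show ?thesis by simp
qed

lemma has_sum_P_right: "((\<lambda>j. P k j) has_sum (real k * rho ^ k)) {1..}"
proof -
  have "((\<lambda>j. (real k * rho ^ k) * (real j * rho ^ j)) has_sum (real k * rho ^ k) * 1) {1..}"
    by (rule has_sum_cmult_right[OF has_sum_size_weights])
  then show ?thesis
    using has_sum_cong[of "{1..}" "P k" "\<lambda>j. (real k * rho ^ k) * (real j * rho ^ j)"] P_eq_product
    by simp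
qed

lemma pi2_eq: "pi2 k = real k * rho ^ k"
  unfolding pi2_def by (rule infsumI[OF has_sum_P_right])

lemma has_sum_pi2: "(pi2 has_sum 1) {1..}"
  using has_sum_size_weights by (simp add: pi2_eq[abs_def])

lemma pi2_pos: "1 \<le> k \<Longrightarrow> 0 < pi2 k"
  using rho_pos by (simp add: pi2_eq)

text \<open>Asymptotic independence of the sizes of two successive columns.\<close>

lemma P_eq: "1 \<le> j \<Longrightarrow> P k j = pi2 k * pi2 j"
  by (simp add: P_eq_product pi2_eq)

lemma Trans_eq: "1 \<le> k \<Longrightarrow> 1 \<le> j \<Longrightarrow> Trans k j = pi2 j"
  using pi2_pos[of k] by (simp only: Trans_def pi2_def[symmetric] P_eq) simp

lemma has_sum_P_left: "1 \<le> j \<Longrightarrow> ((\<lambda>k. P k j) has_sum pi2 j) {1..}"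
  using has_sum_cmult_left[OF has_sum_pi2, of "pi2 j"] by (simp add: P_eq)

lemma has_sum_P: "((\<lambda>(k, j). P k j) has_sum 1) ({1..} \<times> {1..})"
proof (rule has_sum_SigmaI)
  show "((\<lambda>j. case (k, j) of (k, j) \<Rightarrow> P k j) has_sum pi2 k) {1..}" for k
    using has_sum_P_right by (simp add: pi2_eq)
  show "(pi2 has_sum 1) {1..}" by (rule has_sum_pi2)
  show "(\<lambda>(k, j). P k j) summable_on ({1..} \<times> {1..})"
  proof (rule summable_on_SigmaI)
    show "((\<lambda>j. case (k, j) of (k, j) \<Rightarrow> P k j) has_sum pi2 k) {1..}" for k
      using has_sum_P_right by (simp add: pi2_eq)
    show "pi2 summable_on {1..}" using has_sum_pi2 by (auto simp: summable_on_def)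
    show "0 \<le> (case (k, j) of (k, j) \<Rightarrow> P k j)" if "k \<in> {1..}" "j \<in> {1..}" for k j
      using that P_eq[of j k] pi2_pos[of k] pi2_pos[of j] by simp
  qed
qed

section \<open>Column sizes in the asymptotic regime\<close>

text \<open>An error of order \<open>\<surd>n\<close> in the width is negligible after division by \<open>n\<close>.\<close>

lemma regime_critical:
  assumes "regime m m1"
  shows "critical m (\<lambda>n. n)"
proof -
  have N: "filterlim (\<lambda>n. real n) at_top sequentially"
    by (rule filterlim_real_sequentially)
  obtain c where c: "eventually (\<lambda>n. norm (real (m n) - real n / sqrt 5) \<le> c * norm (sqrt (real n))) sequentially"
    using assms unfolding regime_def bigo_def by blast
  have "(\<lambda>n. inverse (sqrt (real n))) \<longlonglongrightarrow> 0"
    by (intro tendsto_inverse_0_at_top filterlim_compose[OF sqrt_at_top N])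
  then have z: "(\<lambda>n. c * inverse (sqrt (real n))) \<longlonglongrightarrow> 0"
    by (rule tendsto_mult_right_zero)
  have "(\<lambda>n. real (m n) / real n - 1 / sqrt 5) \<longlonglongrightarrow> 0"
  proof (rule Lim_null_comparison[OF _ z])
    show "eventually (\<lambda>n. norm (real (m n) / real n - 1 / sqrt 5) \<le> c * inverse (sqrt (real n))) sequentially"
      using c eventually_gt_at_top[of 0]
    proof eventually_elim
      case (elim n)
      have "real (m n) / real n - 1 / sqrt 5 = (real (m n) - real n / sqrt 5) / real n"
        using elim(2) by (simp add: diff_divide_distrib)
      then have "norm (real (m n) / real n - 1 / sqrt 5) = norm (real (m n) - real n / sqrt 5) / real n"
        by simp
      also have "\<dots> \<le> c * sqrt (real n) / real n"
        using elim by (intro divide_right_mono) auto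
      also have "\<dots> = c * inverse (sqrt (real n))"
        using elim(2) by (simp add: real_div_sqrt field_simps)
      finally show ?case .
    qed
  qed
  then have "(\<lambda>n. real (m n) / real n) \<longlonglongrightarrow> 1 / sqrt 5"
    by (simp add: LIM_zero_iff)
  with N show ?thesis by (simp add: critical_def)
qed

lemma regime_intermediate:
  assumes "regime m m1"
  shows "eventually (\<lambda>n. 0 < m1 n \<and> Suc (m1 n) < m n) sequentially"
proof -
  obtain c where c: "c > 0" "eventually (\<lambda>n. c * real n \<le> real (m1 n) \<and> c * real n \<le> real (m n) - real (m1 n)) sequentially"
    using assms unfolding regime_def by blast
  have "filterlim (\<lambda>n. c * real n) at_top sequentially"
    by (intro filterlim_tendsto_pos_mult_at_top[OF tendsto_const c(1)] filterlim_real_sequentially)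
  then have "eventually (\<lambda>n. 1 < c * real n) sequentially"
    by (simp add: filterlim_at_top_dense)
  with c(2) show ?thesis
    by eventually_elim auto
qed

lemma column_size_limit:
  assumes m: "critical m (\<lambda>n. n)" and i: "eventually (\<lambda>n. 0 < i n \<and> i n < m n) sequentially"
  shows "(\<lambda>n. real (Xi_col (m n) n (i n) k) / real (T (m n) n)) \<longlonglongrightarrow> pi2 k"
proof -
  have "(\<lambda>n. real k * (real (T (m n - 1) (n - k)) / real (T (m n) n))) \<longlonglongrightarrow> pi2 k"
    unfolding pi2_eq by (intro tendsto_intros T_remove_column_cells_limit[OF m])
  moreover have "eventually (\<lambda>n. real k * (real (T (m n - 1) (n - k)) / real (T (m n) n)) =
      real (Xi_col (m n) n (i n) k) / real (T (m n) n)) sequentially"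
    using i eventually_ge_at_top[of k]
  proof eventually_elim
    case (elim n)
    then show ?case using Xi_col_eq_T[of "i n - 1" "m n" k n] by simp
  qed
  ultimately show ?thesis by (rule Lim_transform_eventually)
qed

text \<open>Two columns are cut out one after the other. The second cut starts from width \<open>m n - 1\<close> and area
  \<open>n - k\<close>, which still have the critical density.\<close>

lemma successive_column_sizes_limit:
  assumes m: "critical m (\<lambda>n. n)" and i: "eventually (\<lambda>n. 0 < i n \<and> Suc (i n) < m n) sequentially"
    and j: "1 \<le> j"
  shows "(\<lambda>n. real (Xi (m n) n (i n) k j) / real (T (m n) n)) \<longlonglongrightarrow> P k j"
proof -
  have crit: "critical (\<lambda>n. m n - 1) (\<lambda>n. n - k)"
    by (intro critical_remove_cells critical_remove_column m)
  have "(\<lambda>n. (real k * (real (T (m n - 1) (n - k)) / real (T (m n) n))) *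
      (real j * (real (T (m n - 1 - 1) (n - k - j)) / real (T (m n - 1) (n - k))))) \<longlonglongrightarrow> P k j"
    unfolding P_eq[OF j] pi2_eq
    by (intro tendsto_intros T_remove_column_cells_limit[OF m] T_remove_column_cells_limit[OF crit])
  moreover have "eventually (\<lambda>n. (real k * (real (T (m n - 1) (n - k)) / real (T (m n) n))) *
      (real j * (real (T (m n - 1 - 1) (n - k - j)) / real (T (m n - 1) (n - k)))) =
      real (Xi (m n) n (i n) k j) / real (T (m n) n)) sequentially"
    using i eventually_ge_at_top[of "k + j"] critical_eventually[OF crit, of 0 0]
  proof eventually_elim
    case (elim n)
    then show ?case
      using Xi_eq_T[of "i n - 1" "m n" k j n] T_pos[of "m n - 1" "n - k"] by simp
  qed
  ultimately show ?thesis by (rule Lim_transform_eventually)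
qed

lemma transition_limit:
  assumes m: "critical m (\<lambda>n. n)" and i: "eventually (\<lambda>n. 0 < i n \<and> Suc (i n) < m n) sequentially"
    and k: "1 \<le> k" and j: "1 \<le> j"
  shows "(\<lambda>n. real (Xi (m n) n (i n) k j) / real (Xi_col (m n) n (i n) k)) \<longlonglongrightarrow> Trans k j"
proof -
  have "eventually (\<lambda>n. 0 < i n \<and> i n < m n) sequentially"
    using i by eventually_elim simp
  then have "(\<lambda>n. (real (Xi (m n) n (i n) k j) / real (T (m n) n)) /
      (real (Xi_col (m n) n (i n) k) / real (T (m n) n))) \<longlonglongrightarrow> P k j / pi2 k"
    using pi2_pos[OF k]
    by (intro tendsto_divide successive_column_sizes_limit column_size_limit m i j) auto
  also have "P k j / pi2 k = Trans k j"
    by (simp add: Trans_def pi2_def)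
  finally show ?thesis
  proof (rule Lim_transform_eventually)
    show "eventually (\<lambda>n. (real (Xi (m n) n (i n) k j) / real (T (m n) n)) /
        (real (Xi_col (m n) n (i n) k) / real (T (m n) n)) =
        real (Xi (m n) n (i n) k j) / real (Xi_col (m n) n (i n) k)) sequentially"
      using critical_eventually[OF m, of 0 0]
      by eventually_elim (use T_pos in \<open>simp add: less_imp_le\<close>)
  qed
qed

theorem theorem2p4:
  shows
    "(C2 has_sum C2_total) {1..} \<and> C2_total = (sqrt 5 - 1) / 2 \<and>
     (\<forall>k\<ge>1. \<forall>j\<ge>1. P k j = pi1 k * real k * C2 j) \<and>
     (\<forall>k\<ge>1. \<forall>j\<ge>1. 0 \<le> P k j) \<and>
     ((\<lambda>(k, j). P k j) has_sum 1) ({1..} \<times> {1..}) \<and>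
     (\<forall>m m1. regime m m1 \<longrightarrow> (\<forall>k\<ge>1. \<forall>j\<ge>1.
        (\<lambda>n. real (Xi (m n) n (m1 n) k j) / real (T (m n) n)) \<longlonglongrightarrow> P k j)) \<and>
     (\<forall>m m1. regime m m1 \<longrightarrow>
        (\<forall>k\<ge>1. (\<lambda>n. real (Xi_col (m n) n (m1 n) k) / real (T (m n) n)) \<longlonglongrightarrow> pi2 k) \<and>
        (\<forall>j\<ge>1. (\<lambda>n. real (Xi_col (m n) n (m1 n + 1) j) / real (T (m n) n)) \<longlonglongrightarrow> pi2 j) \<and>
        (\<forall>k\<ge>1. \<forall>j\<ge>1.
          (\<lambda>n. real (Xi (m n) n (m1 n) k j) / real (Xi_col (m n) n (m1 n) k))
            \<longlonglongrightarrow> Trans k j)) \<and>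
     (\<forall>k\<ge>1.
        ((\<lambda>j. P k j) has_sum pi2 k) {1..} \<and>
        ((\<lambda>j. pi1 k * U k j * C2 j) has_sum pi2 k) {1..} \<and>
        pi2 k = pi1 k * real k * C2_total \<and>
        pi2 k = real k * rho ^ k) \<and>
     (\<forall>j\<ge>1.
        ((\<lambda>k. P k j) has_sum pi2 j) {1..} \<and>
        ((\<lambda>k. pi1 k * U k j * C2 j) has_sum pi2 j) {1..}) \<and>
     (pi2 has_sum 1) {1..} \<and>
     (\<forall>k\<ge>1. \<forall>j\<ge>1.
        Trans k j = P k j / (\<Sum>\<^sub>\<infinity>i\<in>{1..}. P k i) \<and>
        (\<lambda>i. U k i * C2 i) summable_on {1..} \<and>
        Trans k j = U k j * C2 j / (\<Sum>\<^sub>\<infinity>i\<in>{1..}. U k i * C2 i) \<and>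
        Trans k j = C2 j / C2_total \<and>
        Trans k j = real j * rho ^ j) \<and>
     (\<forall>k\<ge>1. (Trans k has_sum 1) {1..}) \<and>
     (\<forall>j\<ge>1. ((\<lambda>k. pi2 k * Trans k j) has_sum pi2 j) {1..})"
proof (intro conjI allI impI)
  fix k j :: nat assume k: "1 \<le> k" and j: "1 \<le> j"
  show "P k j = pi1 k * real k * C2 j" by (simp add: P_def U_def)
  show "0 \<le> P k j" using P_eq[OF j, of k] pi2_pos[OF k] pi2_pos[OF j] by simp
  show "Trans k j = P k j / (\<Sum>\<^sub>\<infinity>i\<in>{1..}. P k i)" by (rule Trans_def)
  have U: "((\<lambda>i. U k i * C2 i) has_sum real k * C2_total) {1..}"
    unfolding U_def C2_total_eq by (rule has_sum_cmult_right[OF has_sum_C2])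
  then show "(\<lambda>i. U k i * C2 i) summable_on {1..}" by (auto simp: summable_on_def)
  show C2: "Trans k j = C2 j / C2_total"
    using sqrt5_greater by (simp add: Trans_eq[OF k j] pi2_eq C2_eq[OF j] C2_total_eq)
  show "Trans k j = U k j * C2 j / (\<Sum>\<^sub>\<infinity>i\<in>{1..}. U k i * C2 i)"
    unfolding C2 infsumI[OF U] using k by (simp add: U_def)
  show "Trans k j = real j * rho ^ j" by (simp add: Trans_eq[OF k j] pi2_eq)
next
  fix m m1 and k j :: nat assume "regime m m1" "1 \<le> k" "1 \<le> j"
  then show "(\<lambda>n. real (Xi (m n) n (m1 n) k j) / real (T (m n) n)) \<longlonglongrightarrow> P k j"
    by (intro successive_column_sizes_limit regime_critical regime_intermediate)
next
  fix m m1 and k :: nat assume r: "regime m m1"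
  show "(\<lambda>n. real (Xi_col (m n) n (m1 n) k) / real (T (m n) n)) \<longlonglongrightarrow> pi2 k"
    using r by (intro column_size_limit regime_critical eventually_mono[OF regime_intermediate]) auto
next
  fix m m1 and j :: nat assume r: "regime m m1"
  show "(\<lambda>n. real (Xi_col (m n) n (m1 n + 1) j) / real (T (m n) n)) \<longlonglongrightarrow> pi2 j"
    using r by (intro column_size_limit regime_critical eventually_mono[OF regime_intermediate]) auto
next
  fix m m1 and k j :: nat assume "regime m m1" "1 \<le> k" "1 \<le> j"
  then show "(\<lambda>n. real (Xi (m n) n (m1 n) k j) / real (Xi_col (m n) n (m1 n) k)) \<longlonglongrightarrow> Trans k j"
    by (intro transition_limit regime_critical regime_intermediate)
next
  fix k :: nat assume k: "1 \<le> k"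
  show "((\<lambda>j. P k j) has_sum pi2 k) {1..}" using has_sum_P_right by (simp add: pi2_eq)
  then show "((\<lambda>j. pi1 k * U k j * C2 j) has_sum pi2 k) {1..}" by (simp add: P_def)
  show "pi2 k = real k * rho ^ k" by (rule pi2_eq)
  show "pi2 k = pi1 k * real k * C2_total"
    by (simp add: pi2_eq pi1_def C2_total_eq field_simps)
  show "(Trans k has_sum 1) {1..}"
    using has_sum_cong[of "{1..}" "Trans k" pi2] Trans_eq[OF k] has_sum_pi2 by simp
next
  fix j :: nat assume j: "1 \<le> j"
  show "((\<lambda>k. P k j) has_sum pi2 j) {1..}" by (rule has_sum_P_left[OF j])
  then show "((\<lambda>k. pi1 k * U k j * C2 j) has_sum pi2 j) {1..}" by (simp add: P_def)
  have "((\<lambda>k. pi2 k * pi2 j) has_sum pi2 j) {1..}"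
    using has_sum_P_left[OF j] by (simp add: P_eq[OF j])
  then show "((\<lambda>k. pi2 k * Trans k j) has_sum pi2 j) {1..}"
    using has_sum_cong[of "{1..}" "\<lambda>k. pi2 k * Trans k j" "\<lambda>k. pi2 k * pi2 j"] Trans_eq[OF _ j] by simp
next
  show "(C2 has_sum C2_total) {1..}" using has_sum_C2 by (simp add: C2_total_eq)
qed (rule C2_total_eq has_sum_P has_sum_pi2)+

end
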